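(* Let $I\subseteq(0,\infty)$ be an interval with $\inf I=0$, let $R\subseteq\mathbb{R}$ be a subring containing $1$, and let $\mathscr{M}$ be a symmetric and monotone $R$-weighted mean on $I$. Then $$\mathscr{H}_{\mathbf 1}(\mathscr{M})=\sup_{\lambda\in W^0(R)}\mathscr{H}_\lambda(\mathscr{M}),$$ where $\mathbf 1=(1,1,1,\dots)$.
   Context: For an interval $I\subseteq\mathbb{R}$ and a subring $R\subseteq\mathbb{R}$ (with $1\in R$), let $W_n(R)=\{(\lambda_1,\dots,\lambda_n)\in R^n:\lambda_1,\dots,\lambda_n\ge0,\ \lambda_1+\cdots+\lambda_n>0\}$. An $R$-weighted mean on $I$ is a function $\mathscr{M}:\bigcup_{n\ge1}I^n\times W_n(R)\to I$ such that for all $n$: (1) nullhomogeneity in the weights: $\mathscr{M}(x,\lambda)=\mathscr{M}(x,t\lambda)$ for all $x\in I^n$, $\lambda\in W_n(R)$ and $t\in R$, $t>0$; (2) reduction principle: $\mathscr{M}(x,\lambda+\mu)=\mathscr{M}(x\odot x,\lambda\odot\mu)$ for all $x\in I^n$, $\lambda,\mu\in W_n(R)$, where $(p_1,\dots,p_n)\odot(q_1,\dots,q_n):=(p_1,q_1,\dots,p_n,q_n)$; (3) mean value property: $\min_i x_i\le\mathscr{M}(x,\lambda)\le\max_i x_i$; (4) elimination principle: if $\lambda_j=0$, then $\mathscr{M}(x,\lambda)$ is unchanged when the $j$-th entry of both $x$ and $\lambda$ is deleted. $\mathscr{M}$ is symmetric if $\mathscr{M}(x,\lambda)=\mathscr{M}(x\circ\sigma,\lambda\circ\sigma)$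 for all $n$, $x\in I^n$, $\lambda\in W_n(R)$ and permutations $\sigma\in S_n$. It is monotone if $\mathscr{M}(x,\lambda)$ is nondecreasing in each variable $x_i$. $W^0(R)$ denotes the set of sequences $\lambda=(\lambda_n)_{n=1}^\infty$ in $R$ with $\lambda_1>0$ and $\lambda_n\ge0$ for all $n\geq 2$. For $\lambda\in W^0(R)$, the $\lambda$-Hardy constant $\mathscr{H}_\lambda(\mathscr{M})$ is the smallest extended real number $C$ such that $\sum_{n=1}^\infty\lambda_n\,\mathscr{M}((x_1,\dots,x_n),(\lambda_1,\dots,\lambda_n))\le C\sum_{n=1}^\infty\lambda_nx_n$ for all sequences $(x_n)$ in $I$. *)

theory Defs
  imports "HOL-Analysis.Analysis" "HOL-Combinatorics.List_Permutation"
begin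

definition real_subring :: "real set \<Rightarrow> bool" where
  "real_subring R \<longleftrightarrow>
     0 \<in> R \<and> 1 \<in> R \<and> (\<forall>a\<in>R. \<forall>b\<in>R. a + b \<in> R \<and> a - b \<in> R \<and> a * b \<in> R)"

text \<open>
  The tuples in \<open>I\<^sup>n\<close> and \<open>W\<^sub>n(R)\<close> are lists of length \<open>n\<close>. As the sum of the
  weights is positive, there are none of length \<open>0\<close>, so quantifying over all \<open>n\<close> amounts to \<open>n \<ge> 1\<close>.
\<close>

definition tuples :: "nat \<Rightarrow> 'a set \<Rightarrow> 'a list set" where
  "tuples n A = {xs. length xs = n \<and> set xs \<subseteq> A}"

definition weights :: "nat \<Rightarrow> real set \<Rightarrow> real list set" where
  "weights n R = {ws \<in> tuples n R. (\<forall>w\<in>set ws. 0 \<le> w) \<and> 0 < sum_list ws}"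

definition delete_nth :: "nat \<Rightarrow> 'a list \<Rightarrow> 'a list" where
  "delete_nth j xs = take j xs @ drop (Suc j) xs"

text \<open>
  A mean is a total function on pairs of lists, constrained only on the union over \<open>n\<close> of
  \<open>I\<^sup>n \<times> W\<^sub>n(R)\<close>. On lists of equal length, \<^const>\<open>splice\<close> is the operation \<open>\<odot>\<close>.
\<close>

definition weighted_mean ::
  "real set \<Rightarrow> real set \<Rightarrow> (real list \<Rightarrow> real list \<Rightarrow> real) \<Rightarrow> bool" where
  "weighted_mean R I M \<longleftrightarrow>
     (\<forall>n. \<forall>xs\<in>tuples n I. \<forall>ws\<in>weights n R. M xs ws \<in> I) \<and>
     (\<forall>n. \<forall>xs\<in>tuples n I. \<forall>ws\<in>weights n R. \<forall>t\<in>R. 0 < t \<longrightarrow>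
        M xs ws = M xs (map (\<lambda>w. t * w) ws)) \<and>
     (\<forall>n. \<forall>xs\<in>tuples n I. \<forall>ws\<in>weights n R. \<forall>vs\<in>weights n R.
        M xs (map2 (+) ws vs) = M (splice xs xs) (splice ws vs)) \<and>
     (\<forall>n. \<forall>xs\<in>tuples n I. \<forall>ws\<in>weights n R.
        Min (set xs) \<le> M xs ws \<and> M xs ws \<le> Max (set xs)) \<and>
     (\<forall>n. \<forall>xs\<in>tuples n I. \<forall>ws\<in>weights n R. \<forall>j<n. ws ! j = 0 \<longrightarrow>
        M xs ws = M (delete_nth j xs) (delete_nth j ws))"

definition symmetric_mean ::
  "real set \<Rightarrow> real set \<Rightarrow> (real list \<Rightarrow> real list \<Rightarrow> real) \<Rightarrow> bool" where
  "symmetric_mean R I M \<longleftrightarrow>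
     (\<forall>n. \<forall>xs\<in>tuples n I. \<forall>ws\<in>weights n R. \<forall>\<sigma>. \<sigma> permutes {..<n} \<longrightarrow>
        M xs ws = M (permute_list \<sigma> xs) (permute_list \<sigma> ws))"

definition monotone_mean ::
  "real set \<Rightarrow> real set \<Rightarrow> (real list \<Rightarrow> real list \<Rightarrow> real) \<Rightarrow> bool" where
  "monotone_mean R I M \<longleftrightarrow>
     (\<forall>n. \<forall>xs\<in>tuples n I. \<forall>ws\<in>weights n R. \<forall>i<n. \<forall>y\<in>I. xs ! i \<le> y \<longrightarrow>
        M xs ws \<le> M (xs[i := y]) ws)"

text \<open>
  Sequences are indexed from \<open>0\<close>: \<open>l n\<close> and \<open>x n\<close> stand for \<open>\<lambda>\<^bsub>n+1\<^esub>\<close> and \<open>x\<^bsub>n+1\<^esub>\<close>.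
\<close>

definition W0 :: "real set \<Rightarrow> (nat \<Rightarrow> real) set" where
  "W0 R = {l. (\<forall>n. l n \<in> R) \<and> 0 < l 0 \<and> (\<forall>n\<ge>1. 0 \<le> l n)}"

definition hardy_bound ::
  "real set \<Rightarrow> (real list \<Rightarrow> real list \<Rightarrow> real) \<Rightarrow> (nat \<Rightarrow> real) \<Rightarrow> ereal \<Rightarrow> bool" where
  "hardy_bound I M l C \<longleftrightarrow>
     (\<forall>x. (\<forall>n. x n \<in> I) \<longrightarrow>
        (\<Sum>n. ereal (l n * M (map x [0..<Suc n]) (map l [0..<Suc n])))
          \<le> C * (\<Sum>n. ereal (l n * x n)))"

text \<open>
  For a weighted mean on an interval \<open>I \<subseteq> (0,\<infinity>)\<close> with infimum \<open>0\<close> and \<open>l \<in> W\<^sup>0(R)\<close>, the least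
  bound exists, see \<open>hardy_const_least\<close> below.
\<close>

definition hardy_const ::
  "real set \<Rightarrow> (real list \<Rightarrow> real list \<Rightarrow> real) \<Rightarrow> (nat \<Rightarrow> real) \<Rightarrow> ereal" where
  "hardy_const I M l = (LEAST C. hardy_bound I M l C)"

lemma hardy_const_least:
  assumes I: "I \<noteq> {}" "I \<subseteq> {0<..}" "Inf I = 0"
    and M: "weighted_mean R I M" and l: "l \<in> W0 R"
  shows "hardy_bound I M l (hardy_const I M l)"
    and "hardy_const I M l = Inf {C. hardy_bound I M l C}"
proof -
  define L where "L x = (\<Sum>n. ereal (l n * M (map x [0..<Suc n]) (map l [0..<Suc n])))" for x
  define S where "S x = (\<Sum>n. ereal (l n * x n))" for x
  have hb: "hardy_bound I M l C \<longleftrightarrow> (\<forall>x. (\<forall>n. x n \<in> I) \<longrightarrow> L x \<le> C * S x)" for C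
    by (simp add: hardy_bound_def L_def S_def)
  have l_nonneg: "0 \<le> l n" for n
    using l by (cases n) (auto simp: W0_def intro: less_imp_le)
  have l0: "0 < l 0" using l by (simp add: W0_def)
  have series_pos: "0 < (\<Sum>n. ereal (f n))" if f: "\<And>n. 0 \<le> f n" "0 < f 0" for f :: "nat \<Rightarrow> real"
  proof -
    have "0 < ereal (f 0)" using f by simp
    also have "\<dots> = (\<Sum>n<1. ereal (f n))" by simp
    also have "\<dots> \<le> (\<Sum>n. ereal (f n))" by (rule suminf_upper) (use f in simp)
    finally show ?thesis .
  qed
  have S_pos: "0 < S x" if x: "\<And>n. x n \<in> I" for x
    unfolding S_def using I(2) l0 l_nonneg x
    by (intro series_pos mult_nonneg_nonneg mult_pos_pos) (auto simp: subset_iff less_imp_le)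
  have L_pos: "0 < L x" if x: "\<And>n. x n \<in> I" for x
  proof -
    have *: "M (map x [0..<Suc n]) (map l [0..<Suc n]) \<in> I" for n
    proof -
      have "0 < (\<Sum>k<Suc n. l k)"
        using l0 l_nonneg by (intro sum_pos2[of _ 0]) auto
      then have "map l [0..<Suc n] \<in> weights (Suc n) R"
        using l l_nonneg
        by (auto simp: weights_def tuples_def W0_def interv_sum_list_conv_sum_set_nat
              atLeast0LessThan simp del: upt_Suc)
      moreover have "map x [0..<Suc n] \<in> tuples (Suc n) I"
        using x by (auto simp: tuples_def simp del: upt_Suc)
      ultimately show ?thesis using M by (auto simp: weighted_mean_def simp del: upt_Suc)
    qed
    have pos: "0 < M (map x [0..<Suc n]) (map l [0..<Suc n])" for n
      using *[of n] I(2) by auto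
    show ?thesis
      unfolding L_def using l0 l_nonneg pos[THEN less_imp_le] pos[of 0]
      by (intro series_pos mult_nonneg_nonneg mult_pos_pos)
  qed
  obtain x where x: "\<And>n. x n \<in> I" and S_fin: "S x < \<infinity>"
  proof -
    have "\<exists>y\<in>I. y < (1/2)^n / (l n + 1)" for n
      using I l_nonneg[of n] cInf_lessD[of I "(1/2)^n / (l n + 1)"]
      by (auto simp: add_nonneg_pos)
    then obtain x where x: "\<And>n. x n \<in> I" "\<And>n. x n < (1/2)^n / (l n + 1)" by metis
    have x_pos: "0 < x n" for n using x(1) I(2) by auto
    have le: "l n * x n \<le> (1/2)^n" for n
    proof -
      have "l n * x n \<le> (l n + 1) * x n" using x_pos[of n] by (simp add: algebra_simps)
      also have "\<dots> \<le> (1/2)^n"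
        using x(2)[of n] l_nonneg[of n]
        by (simp add: pos_less_divide_eq add_nonneg_pos mult.commute less_imp_le)
      finally show ?thesis .
    qed
    have "summable (\<lambda>n. l n * x n)"
      by (rule summable_comparison_test'[where g = "\<lambda>n. (1/2)^n" and N = 0])
        (use le l_nonneg x_pos in \<open>auto simp: abs_mult less_imp_le summable_geometric\<close>)
    then have "S x < \<infinity>"
      unfolding S_def by (simp add: suminf_ereal')
    with x(1) show ?thesis by (rule that)
  qed
  let ?C = "Inf {C. hardy_bound I M l C}"
  have ratio_le: "L y / S y \<le> ?C" if y: "\<And>n. y n \<in> I" "S y < \<infinity>" for y
    using y S_pos[of y] by (auto simp: hb le_Inf_iff ereal_divide_le_pos mult.commute)
  have "0 < L x / S x"
    using L_pos[OF x] S_pos[OF x] S_fin by (simp add: ereal_less_divide_iff)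
  then have C_pos: "0 < ?C" using ratio_le[OF x S_fin] by (rule less_le_trans)
  have "L y \<le> ?C * S y" if y: "\<And>n. y n \<in> I" for y
  proof (cases "S y = \<infinity>")
    case True
    moreover have "?C * \<infinity> = \<infinity>" using C_pos by (cases ?C) auto
    ultimately show ?thesis by simp
  next
    case False
    then show ?thesis
      using ratio_le[of y] y S_pos[of y] by (simp add: ereal_divide_le_pos mult.commute)
  qed
  then have "hardy_bound I M l ?C" by (simp add: hb)
  show eq: "hardy_const I M l = ?C"
    unfolding hardy_const_def
    by (rule Least_equality) (use \<open>hardy_bound I M l ?C\<close> in \<open>auto intro: Inf_lower\<close>)
  show "hardy_bound I M l (hardy_const I M l)"
    unfolding eq by fact
qed

end

theory Submission
  imports Defs
begin

text \<open>
  As \<open>\<one> \<in> W\<^sup>0(R)\<close>, only \<open>\<H>\<^sub>\<lambda> \<le> \<H>\<^sub>\<one>\<close> is at stake. By symmetry, reduction and elimination, a mean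
  is a function of finite distributions with masses in \<open>R\<close>, and a monotone one respects the
  stochastic order of the normalised distributions. Given \<open>\<lambda>\<close>, a finite tuple \<open>x\<close> and a large
  integer \<open>q\<close>, let \<open>Y\<close> be the decreasing list with \<open>\<lceil>q \<lambda>\<^sub>i\<rceil>\<close> copies of each \<open>x\<^sub>i\<close>. The empirical
  distribution of the first \<open>m\<close> entries of \<open>Y\<close> dominates the distribution \<open>(x\<^sub>i, \<lambda>\<^sub>i)\<^sub>i\<^sub>\<le>\<^sub>n\<close> whenever
  \<open>m \<le> q (\<lambda>\<^sub>1 + \<dots> + \<lambda>\<^sub>n)\<close>, so the unweighted Hardy inequality for \<open>Y\<close> bounds
  \<open>\<Sum> \<lfloor>q \<lambda>\<^sub>n\<rfloor> \<M>\<^sub>n\<close> by \<open>C \<Sum> \<lceil>q \<lambda>\<^sub>n\<rceil> x\<^sub>n\<close>. Dividing by \<open>q \<rightarrow> \<infinity>\<close> removes the rounding, without any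
  continuity in the weights.
\<close>

section \<open>Finite distributions as multisets of value-weight pairs\<close>

definition total_weight :: "('a \<times> real) multiset \<Rightarrow> real" where
  "total_weight P = (\<Sum>p\<in>#P. snd p)"

lemma total_weight_simps [simp]:
  "total_weight {#} = 0"
  "total_weight (add_mset p P) = snd p + total_weight P"
  "total_weight (P + Q) = total_weight P + total_weight Q"
  by (simp_all add: total_weight_def)

lemma total_weight_mset: "total_weight (mset ps) = sum_list (map snd ps)"
  by (induction ps) auto

lemma total_weight_nonneg: "(\<And>p. p \<in># P \<Longrightarrow> 0 \<le> snd p) \<Longrightarrow> 0 \<le> total_weight P"
  by (induction P) auto

lemma total_weight_pos:
  "P \<noteq> {#} \<Longrightarrow> (\<And>p. p \<in># P \<Longrightarrow> 0 < snd p) \<Longrightarrow> 0 < total_weight P"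
proof (induction P)
  case (add p P)
  have "0 \<le> total_weight P"
    by (rule total_weight_nonneg) (use add.prems in \<open>auto simp: less_imp_le\<close>)
  then show ?case using add.prems(2)[of p] by simp
qed simp

text \<open>The unnormalised tail function of the distribution. Among multisets of equal total
  weight, comparing it at every \<open>c\<close> is the stochastic order.\<close>

definition upper_weight :: "real \<Rightarrow> (real \<times> real) multiset \<Rightarrow> real" where
  "upper_weight c P = total_weight {#p \<in># P. c \<le> fst p#}"

lemma upper_weight_simps [simp]:
  "upper_weight c {#} = 0"
  "upper_weight c (add_mset p P) = (if c \<le> fst p then snd p else 0) + upper_weight c P"
  "upper_weight c (P + Q) = upper_weight c P + upper_weight c Q"
  by (simp_all add: upper_weight_def)

lemma upper_weight_eq_0: "(\<And>p. p \<in># P \<Longrightarrow> fst p < c) \<Longrightarrow> upper_weight c P = 0"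
  by (induction P) (auto simp: not_le[symmetric])

lemma upper_weight_nonneg: "(\<And>p. p \<in># P \<Longrightarrow> 0 \<le> snd p) \<Longrightarrow> 0 \<le> upper_weight c P"
  by (induction P) auto

lemma upper_weight_le_total:
  "(\<And>p. p \<in># P \<Longrightarrow> 0 \<le> snd p) \<Longrightarrow> upper_weight c P \<le> total_weight P"
  by (induction P) (auto simp: add_increasing add_mono)

definition scale_weights :: "real \<Rightarrow> (real \<times> real) multiset \<Rightarrow> (real \<times> real) multiset" where
  "scale_weights t P = {#(fst p, t * snd p). p \<in># P#}"

lemma scale_weights_weight [simp]:
  "total_weight (scale_weights t P) = t * total_weight P"
  "upper_weight c (scale_weights t P) = t * upper_weight c P"
  by (induction P) (auto simp: scale_weights_def algebra_simps)

section \<open>Splicing of lists and prefixes of sorted lists\<close>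

lemma mset_splice: "mset (splice xs ys) = mset xs + mset ys"
  by (induction xs ys rule: splice.induct) auto

lemma zip_splice:
  "length xs = length ws \<Longrightarrow> length ys = length vs \<Longrightarrow> length xs = length ys \<Longrightarrow>
   zip (splice xs ys) (splice ws vs) = splice (zip xs ws) (zip ys vs)"
proof (induction xs arbitrary: ws ys vs)
  case (Cons x xs)
  then show ?case by (cases ws; cases ys; cases vs) auto
qed auto

text \<open>Brings a pair of lists into the form of two projections of one list of pairs, to which
  \<open>mean_mset\<close> applies.\<close>

lemma unzip_eqI:
  assumes "zip xs ws = ps" "length xs = length ws"
  shows "f xs ws = f (map fst ps) (map snd ps)"
  using assms by auto

lemma upper_weight_unit:
  "upper_weight c (mset (map (\<lambda>y. (y, 1)) ys)) = real (length (filter ((\<le>) c) ys))"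
  by (induction ys) auto

text \<open>In a decreasing list the entries that are at least \<open>c\<close> form an initial
  segment; a prefix lies inside that segment or contains all of it.\<close>

lemma length_filter_take_sorted:
  fixes ys :: "'a::linorder list"
  assumes "sorted_wrt (\<ge>) ys"
  shows "length (filter ((\<le>) c) (take m ys)) = min m (length (filter ((\<le>) c) ys))"
  using assms
proof (induction ys arbitrary: m)
  case (Cons a ys)
  show ?case
  proof (cases "c \<le> a")
    case True
    then show ?thesis using Cons by (cases m) auto
  next
    case False
    then have "\<forall>y\<in>set (a # ys). \<not> c \<le> y" using Cons.prems by auto
    then have "filter ((\<le>) c) (a # ys) = []" "filter ((\<le>) c) (take m (a # ys)) = []"
      unfolding filter_empty_conv using set_take_subset by fast+
    then show ?thesis by (simp only: list.size min_0R)
  qed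
qed simp

lemma length_filter_concat_replicate:
  "length (filter P (concat (map (\<lambda>i. replicate (k i) (x i)) is)))
     = (\<Sum>i\<leftarrow>is. if P (x i) then k i else 0)"
  by (induction "is") auto

lemma W0_nonneg: "l \<in> W0 R \<Longrightarrow> 0 \<le> l i"
  by (cases i) (auto simp: W0_def intro: less_imp_le)

lemma W0_sum_pos:
  assumes "l \<in> W0 R"
  shows "0 < (\<Sum>i<Suc n. l i)"
  using assms W0_nonneg[OF assms] by (intro sum_pos2[of _ 0]) (auto simp: W0_def)

section \<open>The mean as a function of multisets\<close>

locale symmetric_monotone_mean =
  fixes R I :: "real set" and M :: "real list \<Rightarrow> real list \<Rightarrow> real"
  assumes subring: "real_subring R"
    and weighted: "weighted_mean R I M"
    and symmetric: "symmetric_mean R I M"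
    and monotone: "monotone_mean R I M"
begin

lemma R_closed:
  "0 \<in> R" "1 \<in> R" "a \<in> R \<Longrightarrow> b \<in> R \<Longrightarrow> a + b \<in> R" "a \<in> R \<Longrightarrow> b \<in> R \<Longrightarrow> a - b \<in> R"
  "a \<in> R \<Longrightarrow> b \<in> R \<Longrightarrow> a * b \<in> R"
  using subring by (auto simp: real_subring_def)

definition admissible :: "(real \<times> real) multiset \<Rightarrow> bool" where
  "admissible P \<longleftrightarrow> (\<forall>p\<in>#P. fst p \<in> I \<and> snd p \<in> R \<and> 0 \<le> snd p) \<and> 0 < total_weight P"

text \<open>On admissible multisets the listing picked by \<open>SOME\<close> is immaterial, by
  symmetry; see \<open>mean_mset\<close>.\<close>

definition mean :: "(real \<times> real) multiset \<Rightarrow> real" where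
  "mean P = (let ps = SOME ps. mset ps = P in M (map fst ps) (map snd ps))"

lemma admissible_mset_iff:
  "admissible (mset ps) \<longleftrightarrow>
     map fst ps \<in> tuples (length ps) I \<and> map snd ps \<in> weights (length ps) R"
  by (auto simp: admissible_def tuples_def weights_def total_weight_mset)

lemma total_weight_in_R: "(\<And>p. p \<in># P \<Longrightarrow> snd p \<in> R) \<Longrightarrow> total_weight P \<in> R"
  by (induction P) (auto intro: R_closed)

lemma mean_mset:
  assumes "admissible (mset ps)"
  shows "mean (mset ps) = M (map fst ps) (map snd ps)"
proof -
  define qs where "qs = (SOME qs. mset qs = mset ps)"
  have qs: "mset qs = mset ps" unfolding qs_def by (rule someI) simp
  obtain \<sigma> where \<sigma>: "\<sigma> permutes {..<length ps}" "permute_list \<sigma> ps = qs"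
    using mset_eq_permutation[OF qs] .
  have "M (map fst ps) (map snd ps)
      = M (permute_list \<sigma> (map fst ps)) (permute_list \<sigma> (map snd ps))"
    using symmetric assms \<sigma>(1) by (auto simp: symmetric_mean_def admissible_mset_iff)
  then show ?thesis
    using \<sigma> by (simp add: mean_def permute_list_map flip: qs_def)
qed

lemma mean_drop_zero:
  assumes "admissible (add_mset (x, 0) P)"
  shows "mean (add_mset (x, 0) P) = mean P"
proof -
  obtain ps where ps: "P = mset ps" using ex_mset by metis
  have adm: "admissible (mset ((x, 0) # ps))" "admissible (mset ps)"
    using assms by (auto simp: ps admissible_def)
  have "M (x # map fst ps) (0 # map snd ps)
      = M (delete_nth 0 (x # map fst ps)) (delete_nth 0 (0 # map snd ps))"
    using weighted adm(1) unfolding weighted_mean_def admissible_mset_iff by fastforce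
  then show ?thesis
    using mean_mset[OF adm(1)] mean_mset[OF adm(2)] by (simp add: ps delete_nth_def)
qed

lemma mean_drop_zeros:
  assumes "admissible P" "\<And>p. p \<in># Q \<Longrightarrow> fst p \<in> I \<and> snd p = 0"
  shows "mean (P + Q) = mean P"
  using assms(2)
proof (induction Q)
  case (add p Q)
  have "total_weight (P + Q) = total_weight P"
    using add.prems by (induction Q) auto
  moreover have "fst q \<in> I \<and> snd q \<in> R \<and> 0 \<le> snd q" if "q \<in># add_mset p Q" for q
    using add.prems[OF that] R_closed(1) by simp
  ultimately have "admissible (add_mset (fst p, 0) (P + Q))"
    using assms(1) R_closed(1) by (auto simp: admissible_def)
  from mean_drop_zero[OF this] show ?case
    using add by (metis add_mset_add_single union_assoc insert_iff prod.collapse set_mset_add_mset_insert)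
qed simp

lemma mean_scale:
  assumes "admissible P" "t \<in> R" "0 < t"
  shows "admissible (scale_weights t P)" "mean (scale_weights t P) = mean P"
proof -
  show adm: "admissible (scale_weights t P)"
    using assms R_closed(5) by (auto simp: admissible_def scale_weights_def[of _ P])
       (simp flip: scale_weights_def)
  obtain ps where ps: "P = mset ps" using ex_mset by metis
  have scaled: "scale_weights t P = mset (map (\<lambda>p. (fst p, t * snd p)) ps)"
    by (simp add: ps scale_weights_def)
  have "M (map fst ps) (map snd ps) = M (map fst ps) (map (\<lambda>w. t * w) (map snd ps))"
    using weighted assms unfolding weighted_mean_def ps admissible_mset_iff by blast
  then show "mean (scale_weights t P) = mean P"
    using mean_mset[of ps] mean_mset[of "map (\<lambda>p. (fst p, t * snd p)) ps"] adm assms(1)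
    unfolding scaled unfolding ps by (simp add: comp_def)
qed

text \<open>The reduction principle is applied to the weight tuples \<open>u # map snd ps\<close>
  and \<open>(v, 0, ..., 0)\<close>; \<open>0 < v\<close> makes the latter a legitimate tuple.
  Splicing duplicates every value of \<open>P\<close> with weight 0, and these copies, collected in
  \<open>Z\<close>, are then eliminated.\<close>

lemma mean_split:
  assumes adm: "admissible (add_mset (x, u + v) P)" and uv: "u \<in> R" "v \<in> R" "0 < u" "0 < v"
  shows "mean (add_mset (x, u + v) P) = mean (add_mset (x, u) (add_mset (x, v) P))"
proof -
  obtain ps where ps: "P = mset ps" using ex_mset by metis
  let ?xs = "x # map fst ps" and ?ws = "u # map snd ps" and ?vs = "v # map (\<lambda>_. 0) ps"
  define Z where "Z = {#(fst p, 0::real). p \<in># P#}"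
  have "0 \<le> total_weight P"
    by (rule total_weight_nonneg) (use adm in \<open>auto simp: admissible_def\<close>)
  then have adm2: "admissible (add_mset (x, u) (add_mset (x, v) P))"
    using adm uv by (auto simp: admissible_def)
  have "total_weight Z = 0"
    unfolding Z_def by (induction P) auto
  then have adm3: "admissible (add_mset (x, u) (add_mset (x, v) P) + Z)"
    using adm2 R_closed(1) by (auto simp: admissible_def Z_def)
  have ws: "?ws \<in> weights (Suc (length ps)) R" and vs: "?vs \<in> weights (Suc (length ps)) R"
    and xs: "?xs \<in> tuples (Suc (length ps)) I"
    using adm uv R_closed(1) \<open>0 \<le> total_weight P\<close>
    by (auto simp: weights_def tuples_def admissible_def ps total_weight_mset sum_list_0
        comp_def add_pos_nonneg)
  have len: "map2 (+) (map snd ps) (map (\<lambda>_. 0) ps) = map snd ps"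
    by (induction ps) auto
  have "M ?xs (map2 (+) ?ws ?vs) = M (splice ?xs ?xs) (splice ?ws ?vs)"
    using weighted xs ws vs unfolding weighted_mean_def by blast
  also have "\<dots> = M (map fst (splice (zip ?xs ?ws) (zip ?xs ?vs)))
      (map snd (splice (zip ?xs ?ws) (zip ?xs ?vs)))"
    by (rule unzip_eqI) (simp_all add: zip_splice del: splice.simps zip_Cons_Cons)
  also have "\<dots> = mean (mset (splice (zip ?xs ?ws) (zip ?xs ?vs)))"
  proof (rule mean_mset[symmetric])
    have "mset (splice (zip ?xs ?ws) (zip ?xs ?vs)) = add_mset (x, u) (add_mset (x, v) P) + Z"
      by (simp add: mset_splice ps Z_def zip_map_map zip_same_conv_map comp_def)
    then show "admissible (mset (splice (zip ?xs ?ws) (zip ?xs ?vs)))"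
      using adm3 by (simp del: splice.simps)
  qed
  also have "mset (splice (zip ?xs ?ws) (zip ?xs ?vs)) = add_mset (x, u) (add_mset (x, v) P) + Z"
    by (simp add: mset_splice ps Z_def zip_map_map zip_same_conv_map comp_def)
  also have "mean \<dots> = mean (add_mset (x, u) (add_mset (x, v) P))"
    by (rule mean_drop_zeros[OF adm2]) (use adm in \<open>auto simp: Z_def admissible_def\<close>)
  finally show ?thesis
    using mean_mset[of "(x, u + v) # ps"] adm by (simp add: len ps)
qed

section \<open>Monotonicity in the stochastic order\<close>

lemma mean_raise_value:
  assumes "admissible (add_mset (x, w) P)" "y \<in> I" "x \<le> y"
  shows "mean (add_mset (x, w) P) \<le> mean (add_mset (y, w) P)"
proof -
  obtain ps where ps: "P = mset ps" using ex_mset by metis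
  have adm: "admissible (mset ((x, w) # ps))" "admissible (mset ((y, w) # ps))"
    using assms by (auto simp: ps admissible_def)
  have "M (x # map fst ps) (w # map snd ps) \<le> M ((x # map fst ps)[0 := y]) (w # map snd ps)"
    using monotone adm(1) assms(2,3) unfolding monotone_mean_def admissible_mset_iff by fastforce
  then show ?thesis
    using mean_mset[OF adm(1)] mean_mset[OF adm(2)] by (simp add: ps)
qed

text \<open>One move of the greedy coupling: mass \<open>p\<close> at \<open>x\<close> passes from
  the active part \<open>A\<close> to the settled part \<open>T\<close> without changing the mean.
  The strict decrease of the size for \<open>p = w\<close> is what makes the coupling
  terminate.\<close>

lemma split_off_weight:
  assumes adm: "admissible (T + A)" and A: "(x, w) \<in># A" and pos: "\<forall>q\<in>#A. 0 < snd q"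
    and p: "p \<in> R" "0 < p" "p \<le> w"
  obtains A' where "admissible (add_mset (x, p) T + A')"
    "mean (T + A) = mean (add_mset (x, p) T + A')" "\<forall>q\<in>#A'. 0 < snd q"
    "total_weight A' = total_weight A - p"
    "\<And>c. upper_weight c A' = upper_weight c A - (if c \<le> x then p else 0)"
    "size A' \<le> size A" "p = w \<Longrightarrow> size A' < size A"
proof -
  obtain A0 where A0: "A = add_mset (x, w) A0" using A by (metis multi_member_split)
  show thesis
  proof (cases "p = w")
    \<comment> \<open>The whole pair moves over; there is nothing to split, and
      \<open>mean_split\<close> would require both parts to be positive.\<close>
    case True
    show ?thesis by (rule that[of A0]) (use True adm pos A0 in simp_all)
  next
    case False
    have "w \<in> R" using adm by (simp add: A0 admissible_def)
    then have diff: "w - p \<in> R" "0 < w - p" using p False R_closed(4) by simp_all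
    have *: "admissible (add_mset (x, p + (w - p)) (T + A0))" using adm by (simp add: A0)
    show ?thesis
    proof (rule that[of "add_mset (x, w - p) A0"])
      show "admissible (add_mset (x, p) T + add_mset (x, w - p) A0)"
        using * p diff by (auto simp: admissible_def)
      show "mean (T + A) = mean (add_mset (x, p) T + add_mset (x, w - p) A0)"
        using mean_split[OF * p(1) diff(1) p(2) diff(2)]
        by (simp add: A0 add_mset_commute)
    qed (use pos diff False in \<open>auto simp: A0\<close>)
  qed
qed

text \<open>
  The greedy coupling: the largest value \<open>x\<close> of \<open>A\<close> is at most the largest value \<open>y\<close> of \<open>B\<close>,
  so as much weight as both carry can be moved from \<open>x\<close> up to \<open>y\<close> and is then put aside in \<open>T\<close>.
\<close>

lemma mean_le_mean_aux:
  assumes "admissible (T + A)" "admissible (T + B)" "\<forall>p\<in>#A. 0 < snd p" "\<forall>p\<in>#B. 0 < snd p"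
    and "total_weight A = total_weight B" "\<And>c. upper_weight c A \<le> upper_weight c B"
  shows "mean (T + A) \<le> mean (T + B)"
  using assms
proof (induction "size A + size B" arbitrary: T A B rule: less_induct)
  case (less A B T)
  note prems = less.prems
  show ?case
  proof (cases "A = {#} \<or> B = {#}")
    case True
    then have "A = {#}" "B = {#}"
      using total_weight_pos[of A] total_weight_pos[of B] prems(3-5)
      by (cases "A = {#}"; cases "B = {#}"; auto)+
    then show ?thesis by simp
  next
    case False
    have maximal: "\<exists>q\<in>#P. \<forall>r\<in>#P. fst r \<le> fst q" if "P \<noteq> {#}" for P :: "(real \<times> real) multiset"
    proof -
      have "Max (fst ` set_mset P) \<in> fst ` set_mset P" using that by (intro Max_in) auto
      then obtain q where "q \<in># P" "fst q = Max (fst ` set_mset P)" by auto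
      then show ?thesis by (intro bexI[of _ q]) auto
    qed
    obtain x w where xw: "(x, w) \<in># A" "\<forall>r\<in>#A. fst r \<le> x" using maximal[of A] False by force
    obtain y v where yv: "(y, v) \<in># B" "\<forall>r\<in>#B. fst r \<le> y" using maximal[of B] False by force
    have x: "x \<in> I" "w \<in> R" "0 < w" and y: "y \<in> I" "v \<in> R" "0 < v"
      using bspec[OF prems(3) xw(1)] bspec[OF prems(4) yv(1)] prems(1,2) xw(1) yv(1)
      by (force simp: admissible_def)+
    \<comment> \<open>Otherwise the tail of \<open>B\<close> at \<open>x\<close> would vanish, while
      that of \<open>A\<close> contains the positive weight \<open>w\<close>.\<close>
    have "x \<le> y"
    proof (rule ccontr)
      assume "\<not> x \<le> y"
      then have "upper_weight x B = 0" using yv(2) by (intro upper_weight_eq_0) force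
      moreover obtain A0 where A0: "A = add_mset (x, w) A0" using xw(1) by (metis multi_member_split)
      have "0 \<le> upper_weight x A0"
        by (rule upper_weight_nonneg) (use prems(3) in \<open>auto simp: A0 less_imp_le\<close>)
      then have "0 < upper_weight x A" using x by (simp add: A0)
      ultimately show False using prems(6)[of x] by simp
    qed
    define p where "p = min w v"
    have p: "p \<in> R" "0 < p" "p \<le> w" "p \<le> v" using x y by (auto simp: p_def min_def)
    obtain A' where A': "admissible (add_mset (x, p) T + A')"
      "mean (T + A) = mean (add_mset (x, p) T + A')" "\<forall>q\<in>#A'. 0 < snd q"
      "total_weight A' = total_weight A - p"
      "\<And>c. upper_weight c A' = upper_weight c A - (if c \<le> x then p else 0)"
      "size A' \<le> size A" "p = w \<Longrightarrow> size A' < size A"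
      using split_off_weight[OF prems(1) xw(1) prems(3) p(1-3)] by metis
    obtain B' where B': "admissible (add_mset (y, p) T + B')"
      "mean (T + B) = mean (add_mset (y, p) T + B')" "\<forall>q\<in>#B'. 0 < snd q"
      "total_weight B' = total_weight B - p"
      "\<And>c. upper_weight c B' = upper_weight c B - (if c \<le> y then p else 0)"
      "size B' \<le> size B" "p = v \<Longrightarrow> size B' < size B"
      using split_off_weight[OF prems(2) yv(1) prems(4) p(1,2,4)] by metis
    have "mean (T + A) = mean (add_mset (x, p) (T + A'))" using A'(2) by simp
    also have "\<dots> \<le> mean (add_mset (y, p) (T + A'))"
      by (rule mean_raise_value) (use A'(1) y \<open>x \<le> y\<close> in simp_all)
    also have "\<dots> = mean (add_mset (y, p) T + A')" by simp
    also have "\<dots> \<le> mean (add_mset (y, p) T + B')"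
    proof (rule less.hyps)
      \<comment> \<open>Since \<open>p\<close> is the smaller of \<open>w\<close> and
        \<open>v\<close>, at least one of the two chosen pairs is used up.\<close>
      show "size A' + size B' < size A + size B"
        using A'(6,7) B'(6,7) by (cases "w \<le> v") (auto simp: p_def min_def)
      show "admissible (add_mset (y, p) T + A')" using A'(1) y by (auto simp: admissible_def)
      \<comment> \<open>For \<open>c\<close> up to \<open>x\<close> both tails lose exactly
        \<open>p\<close>; above \<open>x\<close> the tail of \<open>A\<close> is 0 by maximality of
        \<open>x\<close>.\<close>
      show "upper_weight c A' \<le> upper_weight c B'" for c
      proof (cases "c \<le> x")
        case True
        then show ?thesis using A'(5) B'(5) prems(6)[of c] \<open>x \<le> y\<close> by simp
      next
        case False
        then have "upper_weight c A = 0" using xw(2) by (intro upper_weight_eq_0) force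
        moreover have "0 \<le> upper_weight c B'"
          by (rule upper_weight_nonneg) (use B'(3) in \<open>auto simp: less_imp_le\<close>)
        ultimately show ?thesis using A'(5)[of c] False by simp
      qed
    qed (use A' B' prems(5) in simp_all)
    finally show ?thesis using B'(2) by simp
  qed
qed

lemma weight_positive_part:
  assumes "admissible P"
  shows "total_weight {#p \<in># P. 0 < snd p#} = total_weight P"
    and "upper_weight c {#p \<in># P. 0 < snd p#} = upper_weight c P"
proof -
  have "\<forall>p\<in>#P. 0 \<le> snd p" using assms by (simp add: admissible_def)
  then show "total_weight {#p \<in># P. 0 < snd p#} = total_weight P"
    and "upper_weight c {#p \<in># P. 0 < snd p#} = upper_weight c P"
    by (induction P) auto
qed

lemma mean_positive_part:
  assumes "admissible P"
  shows "admissible {#p \<in># P. 0 < snd p#}" "mean {#p \<in># P. 0 < snd p#} = mean P"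
proof -
  have nonneg: "\<forall>p\<in>#P. 0 \<le> snd p" using assms by (simp add: admissible_def)
  show adm: "admissible {#p \<in># P. 0 < snd p#}"
    using assms by (simp add: admissible_def weight_positive_part[OF assms])
  have "mean ({#p \<in># P. 0 < snd p#} + {#p \<in># P. \<not> 0 < snd p#}) = mean {#p \<in># P. 0 < snd p#}"
    by (rule mean_drop_zeros[OF adm]) (use assms nonneg in \<open>force simp: admissible_def\<close>)
  then show "mean {#p \<in># P. 0 < snd p#} = mean P"
    by (simp flip: multiset_partition)
qed

text \<open>Normalising by division could leave \<open>R\<close>, so the order is stated
  cross-multiplied, and each multiset is scaled by the total weight of the other. This equalises the
  totals; dropping the zero weights then gives the positive masses that the coupling asks
  for.\<close>

lemma mean_le_mean:
  assumes A: "admissible A" and B: "admissible B"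
    and le: "\<And>c. upper_weight c A * total_weight B \<le> upper_weight c B * total_weight A"
  shows "mean A \<le> mean B"
proof -
  let ?A = "scale_weights (total_weight B) A" and ?B = "scale_weights (total_weight A) B"
  have tA: "total_weight A \<in> R" "0 < total_weight A" and tB: "total_weight B \<in> R" "0 < total_weight B"
    using A B by (auto simp: admissible_def intro: total_weight_in_R)
  note A' = mean_scale[OF A tB] and B' = mean_scale[OF B tA]
  have "mean ({#} + {#p \<in># ?A. 0 < snd p#}) \<le> mean ({#} + {#p \<in># ?B. 0 < snd p#})"
    using mean_positive_part(1)[OF A'(1)] mean_positive_part(1)[OF B'(1)] le
      weight_positive_part[OF A'(1)] weight_positive_part[OF B'(1)]
    by (intro mean_le_mean_aux) (auto simp: mult.commute)
  then show ?thesis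
    using mean_positive_part(2)[OF A'(1)] mean_positive_part(2)[OF B'(1)] A'(2) B'(2) by simp
qed

text \<open>Fix a threshold \<open>c\<close>. Either the prefix consists of values that are at least
  \<open>c\<close>, and its normalised tail is 1, or it contains every such copy in
  \<open>Y\<close>. In the second case their number is at least \<open>q\<close> times the weighted
  tail, whereas the prefix length is at most \<open>q\<close> times the total weight.\<close>

lemma mean_le_unit_weights:
  assumes l: "l \<in> W0 R" and x: "\<And>i. x i \<in> I" and n: "n < N" and q: "0 \<le> q"
    and k: "\<And>i. q * l i \<le> real (k i)"
    and Y: "sorted_wrt (\<ge>) Y"
      "mset Y = mset (concat (map (\<lambda>i. replicate (k i) (x i)) [0..<N]))"
    and j: "j < length Y" "real (Suc j) \<le> q * (\<Sum>i<Suc n. l i)"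
  shows "M (map x [0..<Suc n]) (map l [0..<Suc n])
    \<le> M (take (Suc j) Y) (replicate (Suc j) 1)"
proof -
  note l_nonneg = W0_nonneg[OF l] and lpos = W0_sum_pos[OF l, of n]
  have "set Y = set (concat (map (\<lambda>i. replicate (k i) (x i)) [0..<N]))"
    using Y(2) by (rule mset_eq_setD)
  then have Y_I: "set Y \<subseteq> I" using x by auto
  define A where "A = mset (map (\<lambda>i. (x i, l i)) [0..<Suc n])"
  define B where "B = mset (map (\<lambda>y. (y, 1::real)) (take (Suc j) Y))"
  have total_A: "total_weight A = (\<Sum>i<Suc n. l i)"
    unfolding A_def total_weight_mset
    by (simp add: comp_def interv_sum_list_conv_sum_set_nat atLeast0LessThan del: upt_Suc)
  have total_B: "total_weight B = real (Suc j)"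
    using j(1) unfolding B_def total_weight_mset by (simp add: comp_def sum_list_triv)
  have adm_A: "admissible A"
    using l l_nonneg lpos x unfolding admissible_def total_A by (auto simp: A_def W0_def)
  have adm_B: "admissible B"
    using Y_I R_closed(2) set_take_subset[of "Suc j" Y]
    unfolding admissible_def total_B by (auto simp: B_def)
  have upper_A: "upper_weight c A = (\<Sum>i<Suc n. if c \<le> x i then l i else 0)" for c
    unfolding A_def by (induction n) auto
  have upper_B: "upper_weight c B
      = min (real (Suc j)) (\<Sum>i<N. if c \<le> x i then real (k i) else 0)" for c
  proof -
    have "length (filter ((\<le>) c) Y)
        = length (filter ((\<le>) c) (concat (map (\<lambda>i. replicate (k i) (x i)) [0..<N])))"
      using Y(2) by (metis mset_filter size_mset)
    also have "\<dots> = (\<Sum>i<N. if c \<le> x i then k i else 0)"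
      by (simp add: length_filter_concat_replicate interv_sum_list_conv_sum_set_nat atLeast0LessThan)
    finally show ?thesis
      unfolding B_def upper_weight_unit length_filter_take_sorted[OF Y(1)]
      by (simp add: of_nat_min if_distrib[of real] cong: if_cong)
  qed
  have "mean A \<le> mean B"
  proof (rule mean_le_mean[OF adm_A adm_B])
    fix c
    have A_le: "upper_weight c A \<le> total_weight A"
      by (rule upper_weight_le_total) (use adm_A in \<open>simp add: admissible_def\<close>)
    have A_nonneg: "0 \<le> upper_weight c A"
      by (rule upper_weight_nonneg) (use adm_A in \<open>simp add: admissible_def\<close>)
    show "upper_weight c A * total_weight B \<le> upper_weight c B * total_weight A"
    proof (cases "upper_weight c B = total_weight B")
      case True
      then show ?thesis
        using mult_left_mono[OF A_le, of "total_weight B"] total_B by (simp add: mult.commute)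
    next
      case False
      have "q * upper_weight c A = (\<Sum>i<Suc n. if c \<le> x i then q * l i else 0)"
        unfolding upper_A sum_distrib_left by (intro sum.cong) auto
      also have "\<dots> \<le> (\<Sum>i<Suc n. if c \<le> x i then real (k i) else 0)"
        by (intro sum_mono) (use k in auto)
      \<comment> \<open>\<open>Y\<close> also holds the copies for indices from \<open>Suc n\<close>
        up to \<open>N - 1\<close>; they can only enlarge its tail.\<close>
      also have "\<dots> \<le> (\<Sum>i<N. if c \<le> x i then real (k i) else 0)"
        by (intro sum_mono2) (use n in auto)
      also have "\<dots> = upper_weight c B" using False upper_B[of c] total_B by (simp add: min_def split: if_splits)
      finally have "q * upper_weight c A \<le> upper_weight c B" .
      have "upper_weight c A * total_weight B \<le> upper_weight c A * (q * total_weight A)"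
        using j(2) A_nonneg unfolding total_A total_B by (intro mult_left_mono)
      also have "\<dots> = (q * upper_weight c A) * total_weight A" by simp
      also have "\<dots> \<le> upper_weight c B * total_weight A"
        using \<open>q * upper_weight c A \<le> upper_weight c B\<close> lpos total_A by (intro mult_right_mono) auto
      finally show ?thesis .
    qed
  qed
  moreover have "mean A = M (map x [0..<Suc n]) (map l [0..<Suc n])"
    using mean_mset[OF adm_A[unfolded A_def]]
    unfolding A_def[symmetric] by (simp add: comp_def del: upt_Suc)
  moreover have "mean B = M (take (Suc j) Y) (replicate (Suc j) 1)"
    using mean_mset[OF adm_B[unfolded B_def]] j(1)
    unfolding B_def[symmetric] by (simp add: comp_def map_replicate_const)
  ultimately show ?thesis by simp
qed

section \<open>Transfer of the Hardy inequality from unit weights to arbitrary weights\<close>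

lemma M_in_I:
  assumes "length xs = length ws" "set xs \<subseteq> I" "set ws \<subseteq> R" "\<forall>w\<in>set ws. 0 \<le> w" "0 < sum_list ws"
  shows "M xs ws \<in> I"
  using weighted assms unfolding weighted_mean_def by (auto simp: tuples_def weights_def)

lemma M_prefix_in_I:
  assumes "l \<in> W0 R" "\<And>i. x i \<in> I"
  shows "M (map x [0..<Suc n]) (map l [0..<Suc n]) \<in> I"
  using assms W0_nonneg[OF assms(1)] W0_sum_pos[OF assms(1), of n]
  by (intro M_in_I) (auto simp: W0_def interv_sum_list_conv_sum_set_nat atLeast0LessThan
      simp del: upt_Suc)

lemma one_in_W0: "(\<lambda>_. 1) \<in> W0 R"
  using R_closed(2) by (simp add: W0_def)

text \<open>
  A finite list is continued by a sequence in \<open>I\<close> of arbitrarily small sum; this is where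
  \<open>Inf I = 0\<close> is needed.
\<close>

lemma hardy_bound_finite:
  assumes I: "I \<noteq> {}" "I \<subseteq> {0<..}" "Inf I = 0"
    and bound: "hardy_bound I M (\<lambda>_. 1) (ereal c)" and c: "0 \<le> c" and ys: "set ys \<subseteq> I"
  shows "(\<Sum>m<length ys. M (take (Suc m) ys) (replicate (Suc m) 1)) \<le> c * sum_list ys"
    (is "?L \<le> _")
proof -
  have approx: "?L \<le> c * (sum_list ys + 2 * e)" if e: "0 < e" for e
  proof -
    have "\<exists>y\<in>I. y < e * (1/2)^n" for n :: nat
      using I e cInf_lessD[of I "e * (1/2)^n"] by auto
    then obtain t where t: "\<And>n. t n \<in> I" "\<And>n::nat. t n < e * (1/2)^n" by metis
    define x where "x n = (if n < length ys then ys ! n else t n)" for n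
    have x_I: "x n \<in> I" for n using t(1) ys by (auto simp: x_def)
    \<comment> \<open>A summable majorant of \<open>x\<close>: the geometric part covers the
      continuation \<open>t\<close> and contributes \<open>2 * e\<close> in total.\<close>
    define g where "g n = (if n < length ys then ys ! n else 0) + e * (1/2)^n" for n
    have "(\<lambda>n. if n \<in> {..<length ys} then ys ! n else 0) sums (\<Sum>n<length ys. ys ! n)"
      by (rule sums_If_finite_set) simp
    then have "g sums ((\<Sum>n<length ys. ys ! n) + e * 2)"
      unfolding g_def using geometric_sums[of "1/2::real"]
      by (intro sums_add sums_mult) simp_all
    then have g: "g sums (sum_list ys + 2 * e)"
      by (simp add: sum_list_sum_nth atLeast0LessThan mult.commute)
    have M_nonneg: "0 \<le> M (map x [0..<Suc n]) (map (\<lambda>_. 1) [0..<Suc n])" for n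
      using M_prefix_in_I[where n = n and x = x, OF one_in_W0 x_I] I(2) by (auto simp del: upt_Suc)
    have "x n \<le> g n" for n
      using t(2)[of n] e by (simp add: x_def g_def)
    moreover have "0 \<le> x n" for n using x_I[of n] I(2) by auto
    ultimately have S: "(\<Sum>n. ereal (1 * x n)) \<le> ereal (sum_list ys + 2 * e)"
      unfolding sums_suminf_ereal[OF g, symmetric] by (intro suminf_le_pos) simp_all
    have eq: "M (take (Suc m) ys) (replicate (Suc m) 1)
        = 1 * M (map x [0..<Suc m]) (map (\<lambda>_. 1) [0..<Suc m])" if "m < length ys" for m
    proof -
      have "map x [0..<Suc m] = take (Suc m) ys"
        by (rule nth_equalityI) (use that in \<open>auto simp: x_def simp del: upt_Suc\<close>)
      then show ?thesis by (simp add: map_replicate_const del: upt_Suc)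
    qed
    have "ereal ?L = (\<Sum>m<length ys. ereal (1 * M (map x [0..<Suc m]) (map (\<lambda>_. 1) [0..<Suc m])))"
      using eq by (simp del: upt_Suc take_Suc replicate_Suc)
    also have "\<dots> \<le> (\<Sum>m. ereal (1 * M (map x [0..<Suc m]) (map (\<lambda>_. 1) [0..<Suc m])))"
      by (rule suminf_upper) (use M_nonneg in \<open>simp del: upt_Suc\<close>)
    also have "\<dots> \<le> ereal c * (\<Sum>n. ereal (1 * x n))"
      using bound x_I unfolding hardy_bound_def by blast
    also have "\<dots> \<le> ereal c * ereal (sum_list ys + 2 * e)"
      using S c by (intro ereal_mult_left_mono) simp_all
    finally show ?thesis by simp
  qed
  show ?thesis
  proof (rule field_le_epsilon)
    fix d :: real assume d: "0 < d"
    \<comment> \<open>The summand 1 in the denominator keeps it positive when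
      \<open>c = 0\<close>.\<close>
    define e where "e = d / (2 * c + 1)"
    have "c * (2 * e) \<le> d"
      using c d by (simp add: e_def field_simps)
    then show "?L \<le> c * sum_list ys + d"
      using approx[of e] c d by (simp add: e_def algebra_simps)
  qed
qed

lemma hardy_bound_partial_sum:
  assumes I: "I \<noteq> {}" "I \<subseteq> {0<..}" "Inf I = 0"
    and bound: "hardy_bound I M (\<lambda>_. 1) (ereal c)" and c: "0 \<le> c"
    and l: "l \<in> W0 R" and x: "\<And>i. x i \<in> I"
  shows "(\<Sum>n<N. l n * M (map x [0..<Suc n]) (map l [0..<Suc n])) \<le> c * (\<Sum>n<N. l n * x n)"
proof -
  define m where "m n = M (map x [0..<Suc n]) (map l [0..<Suc n])" for n
  note l_nonneg = W0_nonneg[OF l]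
  have x_nonneg: "0 \<le> x i" for i using x[of i] I(2) by auto
  have m_nonneg: "0 \<le> m n" for n
    using M_prefix_in_I[where n = n and x = x, OF l x] I(2) by (auto simp: m_def simp del: upt_Suc)
  \<comment> \<open>Rounding moves each weight \<open>q * l n\<close> by at most 1, so the total
    error on the right does not depend on \<open>q\<close>.\<close>
  have scaled: "q * ((\<Sum>n<N. l n * m n) - c * (\<Sum>n<N. l n * x n))
      \<le> (\<Sum>n<N. m n) + c * (\<Sum>n<N. x n)" if q: "0 \<le> q" for q
  proof -
    \<comment> \<open>Ceilings give the multiplicities in \<open>Y\<close>, so that its tails are
      large enough. Floors give the block lengths below, so that the prefixes ending in block
      \<open>n\<close> are short enough for comparison with \<open>m n\<close>.\<close>
    define k where "k i = nat \<lceil>q * l i\<rceil>" for i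
    define f where "f i = nat \<lfloor>q * l i\<rfloor>" for i
    have ql: "0 \<le> q * l i" for i using q l_nonneg by simp
    have k: "q * l i \<le> real (k i)" "real (k i) \<le> q * l i + 1" for i
      using ql[of i] unfolding k_def by linarith+
    have f: "real (f i) \<le> q * l i" "q * l i - 1 \<le> real (f i)" for i
      using ql[of i] unfolding f_def by linarith+
    have fk: "f i \<le> k i" for i using f(1)[of i] k(1)[of i] by linarith
    define Z where "Z = concat (map (\<lambda>i. replicate (k i) (x i)) [0..<N])"
    define Y where "Y = rev (sort Z)"
    have Y: "sorted_wrt (\<ge>) Y" "mset Y = mset Z"
      by (simp_all add: Y_def sorted_wrt_rev)
    have Y_I: "set Y \<subseteq> I" using x by (auto simp: Y_def Z_def)
    have sum_Y: "sum_list Y = (\<Sum>i<N. real (k i) * x i)"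
    proof -
      have "sum_list Y = sum_list Z" using Y(2) by (metis sum_mset_sum_list)
      also have "\<dots> = (\<Sum>i<N. real (k i) * x i)"
        unfolding Z_def by (induction N) (auto simp: sum_list_replicate)
      finally show ?thesis .
    qed
    have length_Y: "length Y = (\<Sum>i<N. k i)"
      unfolding Y_def Z_def by (induction N) auto
    define G where "G j = M (take (Suc j) Y) (replicate (Suc j) 1)" for j
    have G_nonneg: "0 \<le> G j" if "j < length Y" for j
    proof -
      have "G j \<in> I"
        unfolding G_def using that Y_I R_closed(2) set_take_subset[of "Suc j" Y]
        by (intro M_in_I) (auto simp: sum_list_replicate simp del: replicate_Suc take_Suc)
      then show ?thesis using I(2) by auto
    qed
    define F where "F n = (\<Sum>i<n. f i)" for n
    have F_le: "F n \<le> length Y" if "n \<le> N" for n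
    proof -
      have "F n \<le> F N" unfolding F_def using that by (intro sum_mono2) auto
      also have "\<dots> \<le> length Y" unfolding F_def length_Y using fk by (intro sum_mono)
      finally show ?thesis .
    qed
    \<comment> \<open>\<open>G j\<close> is the mean of \<open>Suc j\<close> entries, hence the
      strict bound on \<open>j\<close>.\<close>
    have m_le_G: "m n \<le> G j" if "n < N" "j < F (Suc n)" for n j
      unfolding m_def G_def
    proof (rule mean_le_unit_weights[OF l x that(1) q k(1) Y(1) Y(2)[unfolded Z_def]])
      show "j < length Y" using that F_le[of "Suc n"] by simp
      have "real (Suc j) \<le> real (F (Suc n))" using that(2) by simp
      also have "\<dots> \<le> q * (\<Sum>i<Suc n. l i)"
        unfolding F_def of_nat_sum sum_distrib_left by (intro sum_mono f)
      finally show "real (Suc j) \<le> q * (\<Sum>i<Suc n. l i)" .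
    qed
    \<comment> \<open>The block from \<open>F n\<close> to \<open>F (Suc n)\<close> has
      \<open>f n\<close> indices, and each of its terms \<open>G j\<close> is at least
      \<open>m n\<close>.\<close>
    have "(\<Sum>i<n. real (f i) * m i) \<le> (\<Sum>j<F n. G j)" if "n \<le> N" for n
      using that
    proof (induction n)
      case 0
      show ?case by (simp add: F_def)
    next
      case (Suc n)
      have F_Suc: "F (Suc n) = F n + f n" by (simp add: F_def)
      have "real (f n) * m n = (\<Sum>j\<in>{F n..<F (Suc n)}. m n)" by (simp add: F_Suc)
      also have "\<dots> \<le> (\<Sum>j\<in>{F n..<F (Suc n)}. G j)"
        using Suc.prems by (intro sum_mono m_le_G) auto
      finally have "(\<Sum>i<Suc n. real (f i) * m i)
          \<le> (\<Sum>j\<in>{0..<F n}. G j) + (\<Sum>j\<in>{F n..<F (Suc n)}. G j)"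
        using Suc by (simp add: atLeast0LessThan)
      then show ?case
        using sum.atLeastLessThan_concat[of 0 "F n" "F (Suc n)" G]
        by (simp add: F_Suc atLeast0LessThan)
    qed
    from this[of N] have "(\<Sum>n<N. real (f n) * m n) \<le> (\<Sum>j<F N. G j)" by simp
    also have "\<dots> \<le> (\<Sum>j<length Y. G j)"
      using F_le[of N] G_nonneg by (intro sum_mono2) auto
    also have "\<dots> \<le> c * sum_list Y"
      unfolding G_def by (rule hardy_bound_finite[OF I bound c Y_I])
    also have "\<dots> \<le> c * (\<Sum>n<N. (q * l n + 1) * x n)"
      unfolding sum_Y using c k(2) x_nonneg by (intro mult_left_mono sum_mono mult_right_mono)
    finally have "(\<Sum>n<N. real (f n) * m n) \<le> c * (\<Sum>n<N. (q * l n + 1) * x n)" .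
    moreover have "(\<Sum>n<N. (q * l n - 1) * m n) \<le> (\<Sum>n<N. real (f n) * m n)"
      using f(2) m_nonneg by (intro sum_mono mult_right_mono)
    ultimately have "(\<Sum>n<N. (q * l n - 1) * m n) \<le> c * (\<Sum>n<N. (q * l n + 1) * x n)" by simp
    then show ?thesis
      by (simp add: algebra_simps sum.distrib sum_subtractf sum_distrib_left)
  qed
  \<comment> \<open>A positive difference times a large enough \<open>q\<close> would exceed the
    fixed bound in \<open>scaled\<close>.\<close>
  have "(\<Sum>n<N. l n * m n) - c * (\<Sum>n<N. l n * x n) \<le> 0"
  proof (rule ccontr)
    assume "\<not> ?thesis"
    then obtain q :: nat where "(\<Sum>n<N. m n) + c * (\<Sum>n<N. x n)
        < real q * ((\<Sum>n<N. l n * m n) - c * (\<Sum>n<N. l n * x n))"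
      using ex_less_of_nat_mult[of "(\<Sum>n<N. l n * m n) - c * (\<Sum>n<N. l n * x n)"] by auto
    then show False using scaled[of "real q"] by simp
  qed
  then show ?thesis by (simp add: m_def)
qed

text \<open>For finite \<open>C\<close> the partial sums suffice: those on the right stay below the
  full series, so the bound passes to the supremum on the left. It remains to treat the infinite
  values of \<open>C\<close>.\<close>

lemma hardy_bound_weights:
  assumes I: "I \<noteq> {}" "I \<subseteq> {0<..}" "Inf I = 0"
    and bound: "hardy_bound I M (\<lambda>_. 1) C" and l: "l \<in> W0 R"
  shows "hardy_bound I M l C"
  unfolding hardy_bound_def
proof (intro allI impI)
  fix x :: "nat \<Rightarrow> real" assume x: "\<forall>n. x n \<in> I"
  let ?L = "\<lambda>l. (\<Sum>n. ereal (l n * M (map x [0..<Suc n]) (map l [0..<Suc n])))"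
    and ?S = "\<lambda>l. (\<Sum>n. ereal (l n * x n))"
  have S_pos: "0 < ?S l" if l: "l \<in> W0 R" for l
  proof -
    have "0 < l 0 * x 0" using l x I(2) by (intro mult_pos_pos) (auto simp: W0_def)
    then have "0 < ereal (l 0 * x 0)" by simp
    also have "\<dots> = (\<Sum>n<1. ereal (l n * x n))" by simp
    also have "\<dots> \<le> ?S l"
      by (rule suminf_upper) (use W0_nonneg[OF l] x I(2) in \<open>auto simp: less_imp_le subset_iff\<close>)
    finally show ?thesis .
  qed
  have term_nonneg: "0 \<le> l n * M (map x [0..<Suc n]) (map l [0..<Suc n])" if l: "l \<in> W0 R" for l n
    using M_prefix_in_I[where n = n and x = x, OF l] x W0_nonneg[OF l, of n] I(2)
    by (auto simp del: upt_Suc)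
  \<comment> \<open>With unit weights the right-hand series is positive and the left-hand one
    nonnegative, which excludes a negative \<open>C\<close>.\<close>
  have C_nonneg: "0 \<le> C"
  proof (rule ccontr)
    assume "\<not> 0 \<le> C"
    then have "C * ?S (\<lambda>_. 1) < 0"
      using S_pos[OF one_in_W0] by (simp add: ereal_mult_less_0_iff not_le)
    moreover have "0 \<le> ?L (\<lambda>_. 1)"
      using term_nonneg[OF one_in_W0] by (intro suminf_0_le) (simp del: upt_Suc)
    moreover have "?L (\<lambda>_. 1) \<le> C * ?S (\<lambda>_. 1)"
      using bound x unfolding hardy_bound_def by blast
    ultimately show False by simp
  qed
  show "?L l \<le> C * ?S l"
  proof (cases C)
    case (real c)
    have c: "0 \<le> c" using C_nonneg real by simp
    show ?thesis
    proof (rule suminf_bound, rule allI)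
      fix N
      have "(\<Sum>n<N. ereal (l n * M (map x [0..<Suc n]) (map l [0..<Suc n])))
          \<le> ereal (c * (\<Sum>n<N. l n * x n))"
        using hardy_bound_partial_sum[OF I bound[unfolded real] c l, of x N] x by (simp del: upt_Suc)
      also have "\<dots> = ereal c * (\<Sum>n<N. ereal (l n * x n))" by simp
      also have "\<dots> \<le> ereal c * ?S l"
        using c W0_nonneg[OF l] x I(2)
        by (intro ereal_mult_left_mono suminf_upper) (auto simp: less_imp_le subset_iff)
      finally show "(\<Sum>n<N. ereal (l n * M (map x [0..<Suc n]) (map l [0..<Suc n]))) \<le> C * ?S l"
        by (simp only: real)
    qed (use term_nonneg[OF l] in \<open>simp del: upt_Suc\<close>)
  next
    case PInf
    \<comment> \<open>Positivity matters because \<infinity> times 0 is 0 in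
      \<open>ereal\<close>.\<close>
    have "\<infinity> * ?S l = \<infinity>" using S_pos[OF l] by (simp add: less_le)
    then show ?thesis using PInf by simp
  next
    case MInf
    then show ?thesis using C_nonneg by simp
  qed
qed

end

theorem theorem2p8:
  fixes I R :: "real set" and M :: "real list \<Rightarrow> real list \<Rightarrow> real"
  assumes "is_interval I" and "I \<noteq> {}" and "I \<subseteq> {0<..}" and "Inf I = 0"
    and "real_subring R"
    and "weighted_mean R I M" and "symmetric_mean R I M" and "monotone_mean R I M"
  shows "hardy_const I M (\<lambda>_. 1) = (SUP l\<in>W0 R. hardy_const I M l)"
proof -
  interpret symmetric_monotone_mean R I M
    using assms by unfold_locales
  \<comment> \<open>The constant for unit weights is itself a bound, so it becomes a bound for
    \<open>l\<close> and lies above the infimum of these.\<close>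
  have "hardy_const I M l \<le> hardy_const I M (\<lambda>_. 1)" if "l \<in> W0 R" for l
  proof -
    have "hardy_bound I M l (hardy_const I M (\<lambda>_. 1))"
      using hardy_bound_weights[OF assms(2-4) hardy_const_least(1)[OF assms(2-4,6) one_in_W0] that] .
    then show ?thesis
      unfolding hardy_const_least(2)[OF assms(2-4,6) that] by (intro Inf_lower) simp
  qed
  then show ?thesis
    by (intro antisym SUP_least SUP_upper one_in_W0)
qed

end
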